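(* Let $\mathcal{G}$ be a set of $n$-qubit Pauli strings, $\mathfrak{g}=\langle i\mathcal{G}\rangle_{\rm Lie}$, and $G=\exp\mathfrak g$ the corresponding compact Lie group with Haar probability measure $\mu_G$. Let $p$ be a Pauli string with connected component $C_p$ in the commutator graph of $\mathcal{G}$. Then the average graph complexity of $p$ is the average shortest path length from $p$ to the vertices of its component: $$\mathbb{E}_{U\sim\mu_G}\mathsf{G}(U^\dagger pU) = \frac{1}{|C_p|} \sum_{q\in C_p} \ell(p,q).$$
   Context: A Pauli string is an operator $\sigma_1\otimes\cdots\otimes\sigma_n$ with each $\sigma_i\in\{I,X,Y,Z\}$. $\langle i\mathcal{G}\rangle_{\rm Lie}$ is the smallest real Lie algebra (under the matrix commutator) containing $\{ip:p\in\mathcal G\}$. The commutator graph of $\mathcal{G}$ is the undirected graph whose vertices are all $4^n$ Pauli strings, with an edge between $p$ and $q$ iff there is $g\in\mathcal{G}$ such that $[g,p]$ is a nonzero scalar multiple of $q$; $\ell(p,q)$ is the shortest path length between $p$ and $q$. For $U\in G$ one has $U^\dagger pU=\sum_{q\in C_p}c_q\,q$, and the graph complexity is $\mathsf{G}(U^\dagger pU)=\sum_{q\in C_p}\ell(p,q)|c_q|^2$. *)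

theory Defs
  imports "HOL-Probability.Probability"
begin

section \<open>Operators on n qubits\<close>

text \<open>
  The qubits are indexed by an arbitrary finite type \<open>'n\<close>, so that n is \<open>CARD('n)\<close>. The
  computational basis of the n-qubit space is indexed by \<open>'n \<Rightarrow> 2\<close>, which has 2^n elements.
\<close>

type_synonym 'n operator = "complex ^ ('n \<Rightarrow> 2) ^ ('n \<Rightarrow> 2)"

definition cscale :: "complex \<Rightarrow> complex ^ 'a ^ 'b \<Rightarrow> complex ^ 'a ^ 'b" (infixr \<open>*\<^sub>c\<close> 75)
  where "c *\<^sub>c A = (\<chi> x y. c * A $ x $ y)"

definition dagger :: "complex ^ 'a ^ 'b \<Rightarrow> complex ^ 'b ^ 'a"
  where "dagger A = (\<chi> x y. cnj (A $ y $ x))"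

definition commutator :: "complex ^ 'a ^ 'a \<Rightarrow> complex ^ 'a ^ 'a \<Rightarrow> complex ^ 'a ^ 'a"
  where "commutator A B = A ** B - B ** A"

text \<open>
  The library's \<open>exp\<close> does not apply, as matrices are not an instance of its type class.
\<close>

definition matrix_exp :: "complex ^ 'a ^ 'a \<Rightarrow> complex ^ 'a ^ 'a"
  where "matrix_exp A = (\<Sum>k. (((\<lambda>B. A ** B) ^^ k) (mat 1)) /\<^sub>R fact k)"


section \<open>Pauli strings\<close>

datatype pauli = PI | PX | PY | PZ

primrec pauli_matrix :: "pauli \<Rightarrow> complex ^ 2 ^ 2" where
  "pauli_matrix PI = vector [vector [1, 0], vector [0, 1]]"
| "pauli_matrix PX = vector [vector [0, 1], vector [1, 0]]"
| "pauli_matrix PY = vector [vector [0, - \<i>], vector [\<i>, 0]]"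
| "pauli_matrix PZ = vector [vector [1, 0], vector [0, - 1]]"

text \<open>The tensor product of the \<open>\<sigma> i\<close>, written out entrywise (Kronecker product).\<close>

definition pauli_string :: "('n::finite \<Rightarrow> pauli) \<Rightarrow> 'n operator"
  where "pauli_string \<sigma> = (\<chi> x y. \<Prod>i\<in>UNIV. pauli_matrix (\<sigma> i) $ x i $ y i)"

definition pauli_strings :: "('n::finite) operator set"
  where "pauli_strings = range pauli_string"


section \<open>The Lie algebra and the Lie group\<close>

definition real_lie_algebra :: "(complex ^ 'a ^ 'a) set \<Rightarrow> bool"
  where "real_lie_algebra L \<longleftrightarrow>
    subspace L \<and> (\<forall>A\<in>L. \<forall>B\<in>L. commutator A B \<in> L)"

definition generated_lie_algebra :: "('n::finite) operator set \<Rightarrow> 'n operator set"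
  where "generated_lie_algebra \<G> = real_lie_algebra hull ((\<lambda>p. \<i> *\<^sub>c p) ` \<G>)"

definition generated_lie_group :: "('n::finite) operator set \<Rightarrow> 'n operator set"
  where "generated_lie_group \<G> = matrix_exp ` generated_lie_algebra \<G>"

text \<open>
  Only left invariance is required; on a compact group right invariance follows. If \<open>V ** A\<close> were
  not measurable, its \<open>emeasure\<close> would be 0, so the condition for \<open>A = H\<close> includes \<open>V ** H \<subseteq> H\<close>.
\<close>

definition haar_probability_measure ::
    "(complex ^ 'a ^ 'a) set \<Rightarrow> (complex ^ 'a ^ 'a) measure \<Rightarrow> bool"
  where "haar_probability_measure H \<mu> \<longleftrightarrow>
    prob_space \<mu> \<and>
    sets \<mu> = sets (restrict_space borel H) \<and>
    (\<forall>V\<in>H. \<forall>A\<in>sets \<mu>. emeasure \<mu> ((\<lambda>U. V ** U) ` A) = emeasure \<mu> A)"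


section \<open>The commutator graph\<close>

text \<open>
  The edge set, as a relation. It is symmetric and irreflexive, since two Pauli strings either
  commute or anticommute and each squares to the identity.
\<close>

definition commutator_graph :: "('n::finite) operator set \<Rightarrow> ('n operator \<times> 'n operator) set"
  where "commutator_graph \<G> =
    {(p, q). p \<in> pauli_strings \<and> q \<in> pauli_strings \<and>
      (\<exists>g\<in>\<G>. \<exists>c. c \<noteq> 0 \<and> commutator g p = c *\<^sub>c q)}"

definition graph_component :: "('n::finite) operator set \<Rightarrow> 'n operator \<Rightarrow> 'n operator set"
  where "graph_component \<G> p = {q. (p, q) \<in> (commutator_graph \<G>)\<^sup>*}"

definition path_length :: "('n::finite) operator set \<Rightarrow> 'n operator \<Rightarrow> 'n operator \<Rightarrow> nat"
  where "path_length \<G> p q = (LEAST k. (p, q) \<in> commutator_graph \<G> ^^ k)"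


section \<open>Graph complexity\<close>

text \<open>
  The coefficients \<open>c\<close> of the expansion \<open>A = (\<Sum>q\<in>S. c q *\<^sub>c q)\<close>, unique if \<open>S\<close> consists of Pauli
  strings, which are linearly independent.
\<close>

definition expansion_coeff :: "('n::finite) operator set \<Rightarrow> 'n operator \<Rightarrow> 'n operator \<Rightarrow> complex"
  where "expansion_coeff S A =
    (THE c. A = (\<Sum>q\<in>S. c q *\<^sub>c q) \<and> (\<forall>q. q \<notin> S \<longrightarrow> c q = 0))"

definition graph_complexity :: "('n::finite) operator set \<Rightarrow> 'n operator \<Rightarrow> 'n operator \<Rightarrow> real"
  where "graph_complexity \<G> p A =
    (\<Sum>q\<in>graph_component \<G> p.
      real (path_length \<G> p q) * (cmod (expansion_coeff (graph_component \<G> p) A q))\<^sup>2)"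

end

(*
  Write C for the component of p, N for the dimension, U^H for the adjoint of U, and F a q for the
  average of |tr (q U^H a U) / N|^2. If g is a generator anticommuting with a, then
  V = exp (i pi/4 g) lies in the group and conjugates a into i a g, a unit multiple of a neighbour b of
  a in the commutator graph; so left invariance under V gives F a q = F b q, and F a q does not depend
  on a in C. On the other hand tr (q U^H a U) = tr (a U q U^H), and for q in C the operator U q U^H is
  a self-inverse element of the real span of C, because ad of the Lie algebra preserves that span. By
  Parseval the sum over a in C of |tr (a U q U^H) / N|^2 is 1. Hence F p q = 1 / |C|.
*)

theory Submission imports Defs begin

section \<open>Matrix algebra\<close>

lemma cscale_simps:
  fixes A B :: "complex ^ 'a ^ 'b"
  shows "c *\<^sub>c (d *\<^sub>c A) = (c * d) *\<^sub>c A" "1 *\<^sub>c A = A" "0 *\<^sub>c A = 0" "c *\<^sub>c (0 :: complex ^ 'a ^ 'b) = 0"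
    "c *\<^sub>c (A + B) = c *\<^sub>c A + c *\<^sub>c B" "c *\<^sub>c (A - B) = c *\<^sub>c A - c *\<^sub>c B"
    "(c + d) *\<^sub>c A = c *\<^sub>c A + d *\<^sub>c A" "- (c *\<^sub>c A) = (- c) *\<^sub>c A"
  by (simp_all add: cscale_def vec_eq_iff algebra_simps)

lemma scaleR_conv_cscale: "r *\<^sub>R (A :: complex ^ 'a ^ 'b) = complex_of_real r *\<^sub>c A"
  by (simp add: cscale_def vec_eq_iff scaleR_conv_of_real[where 'a = complex])

lemma linear_cscale_left: "linear (\<lambda>c. c *\<^sub>c A)"
  by (rule linearI) (simp_all add: cscale_def vec_eq_iff algebra_simps)

lemma mult_cscale:
  fixes A :: "complex ^ 'b ^ 'a" and B :: "complex ^ 'c ^ 'b"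
  shows "(c *\<^sub>c A) ** B = c *\<^sub>c (A ** B)" "A ** (c *\<^sub>c B) = c *\<^sub>c (A ** B)"
  by (simp_all add: cscale_def vec_eq_iff matrix_matrix_mult_def sum_distrib_left algebra_simps)

lemma matrix_distribs:
  fixes A B :: "complex ^ 'b ^ 'a" and C D :: "complex ^ 'c ^ 'b"
  shows "(A - B) ** C = A ** C - B ** C" "A ** (C - D) = A ** C - A ** D"
    "(A + B) ** C = A ** C + B ** C" "A ** (C + D) = A ** C + A ** D"
  by (simp_all add: vec_eq_iff matrix_matrix_mult_def sum_subtractf sum.distrib algebra_simps)

lemma bounded_bilinear_matrix_mult:
  "bounded_bilinear (\<lambda>(A :: complex ^ 'b::finite ^ 'a::finite) (B :: complex ^ 'c::finite ^ 'b). A ** B)"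
  unfolding bilinear_conv_bounded_bilinear[symmetric] bilinear_def
  by (auto intro!: linearI simp: matrix_distribs scaleR_conv_cscale mult_cscale)

lemmas linear_matrix_mult_left = bounded_linear.linear[OF bounded_bilinear.bounded_linear_right[OF bounded_bilinear_matrix_mult]]
lemmas linear_matrix_mult_right = bounded_linear.linear[OF bounded_bilinear.bounded_linear_left[OF bounded_bilinear_matrix_mult]]

lemma dagger_mat_1 [simp]: "dagger (mat 1) = mat 1"
  by (simp add: dagger_def mat_def vec_eq_iff)

lemma dagger_mult: "dagger (A ** B) = dagger B ** dagger A"
  by (simp add: dagger_def vec_eq_iff matrix_matrix_mult_def mult.commute)

lemma dagger_cscale: "dagger (c *\<^sub>c A) = cnj c *\<^sub>c dagger A"
  by (simp add: dagger_def cscale_def vec_eq_iff)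

lemma dagger_add: "dagger (A + B) = dagger A + dagger B"
  and dagger_diff: "dagger (A - B) = dagger A - dagger B"
  by (simp_all add: dagger_def vec_eq_iff)

lemma linear_dagger: "linear (dagger :: complex ^ 'a ^ 'b \<Rightarrow> _)"
  by (rule linearI) (simp_all add: dagger_add dagger_cscale scaleR_conv_cscale)

lemma trace_cscale: "trace (c *\<^sub>c A) = c * trace A"
  by (simp add: trace_def cscale_def sum_distrib_left)

lemma linear_trace: "linear (trace :: complex ^ 'a ^ 'a \<Rightarrow> complex)"
  by (rule linearI) (simp_all add: trace_add scaleR_conv_cscale trace_cscale scaleR_conv_of_real)

section \<open>The matrix exponential\<close>

text \<open>Linear maps in finite dimension are bounded, so a scalar exponential series dominates.
  An arbitrary linear \<open>T\<close> covers both left multiplication, as in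
  \<open>matrix_exp\<close>, and the commutator with a fixed matrix.\<close>

lemma summable_norm_exp_series:
  fixes T :: "'v::euclidean_space \<Rightarrow> 'v"
  assumes "linear T"
  shows "summable (\<lambda>k. norm ((T ^^ k) x /\<^sub>R fact k))"
proof -
  have "bounded_linear T"
    using assms by (simp add: linear_conv_bounded_linear)
  then obtain K where K: "K \<ge> 0" "\<And>x. norm (T x) \<le> norm x * K"
    using bounded_linear.nonneg_bounded by blast
  have bound: "norm ((T ^^ k) x) \<le> norm x * K ^ k" for k
  proof (induction k)
    case (Suc k)
    have "norm ((T ^^ Suc k) x) \<le> norm ((T ^^ k) x) * K"
      using K(2) by simp
    also have "\<dots> \<le> norm x * K ^ Suc k"
      using mult_right_mono[OF Suc K(1)] by (simp add: algebra_simps)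
    finally show ?case .
  qed simp
  have "summable (\<lambda>k. norm x * (K ^ k /\<^sub>R fact k))"
    by (intro summable_mult summable_exp_generic)
  then show ?thesis
  proof (rule summable_comparison_test'[where N = 0])
    fix k
    have "norm (norm ((T ^^ k) x /\<^sub>R fact k)) = norm ((T ^^ k) x) / fact k"
      by (simp add: divide_inverse mult.commute)
    also have "\<dots> \<le> norm x * K ^ k / fact k"
      by (rule divide_right_mono[OF bound]) simp
    finally show "norm (norm ((T ^^ k) x /\<^sub>R fact k)) \<le> norm x * (K ^ k /\<^sub>R fact k)"
      by (simp add: divide_inverse mult.commute mult.left_commute)
  qed
qed

lemma suminf_matrix_component:
  fixes a :: "nat \<Rightarrow> complex ^ 'b::finite ^ 'a::finite"
  assumes "summable a"
  shows "suminf a $ x $ y = (\<Sum>k. a k $ x $ y)"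
proof -
  have "bounded_linear (\<lambda>A :: complex ^ 'b ^ 'a. A $ x $ y)"
    by (intro bounded_linear_compose[OF bounded_linear_vec_nth] bounded_linear_vec_nth)
  from bounded_linear.suminf[OF this assms] show ?thesis .
qed

text \<open>Each entry of the product is a finite sum of products of complex series, to which the
  scalar Cauchy product theorem applies; entries are bounded by the norm, so they inherit absolute
  convergence.\<close>

lemma matrix_Cauchy_product:
  fixes a :: "nat \<Rightarrow> complex ^ 'b::finite ^ 'a::finite" and b :: "nat \<Rightarrow> complex ^ 'c::finite ^ 'b"
  assumes a: "summable (\<lambda>k. norm (a k))" and b: "summable (\<lambda>k. norm (b k))"
  shows "(\<lambda>k. \<Sum>i\<le>k. a i ** b (k - i)) sums (suminf a ** suminf b)"
unfolding sums_def
proof (intro vec_tendstoI)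
  fix x y
  have entry: "norm (M $ i $ j) \<le> norm M" for M :: "complex ^ 'm::finite ^ 'n::finite" and i j
    by (rule order_trans[OF Finite_Cartesian_Product.norm_nth_le Finite_Cartesian_Product.norm_nth_le])
  have a': "summable (\<lambda>k. norm (a k $ x $ z))" for z
    by (rule summable_comparison_test'[OF a, where N = 0]) (simp add: entry)
  have b': "summable (\<lambda>k. norm (b k $ z $ y))" for z
    by (rule summable_comparison_test'[OF b, where N = 0]) (simp add: entry)
  have "(\<lambda>k. \<Sum>z\<in>UNIV. \<Sum>i\<le>k. a i $ x $ z * b (k - i) $ z $ y) sums
      (\<Sum>z\<in>UNIV. (\<Sum>k. a k $ x $ z) * (\<Sum>k. b k $ z $ y))"
    by (intro sums_sum Cauchy_product_sums a' b')
  also have "(\<lambda>k. \<Sum>z\<in>UNIV. \<Sum>i\<le>k. a i $ x $ z * b (k - i) $ z $ y) =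
      (\<lambda>k. (\<Sum>i\<le>k. a i ** b (k - i)) $ x $ y)"
    by (subst sum.swap) (simp add: matrix_matrix_mult_def)
  also have "(\<Sum>z\<in>UNIV. (\<Sum>k. a k $ x $ z) * (\<Sum>k. b k $ z $ y)) = (suminf a ** suminf b) $ x $ y"
    by (simp add: matrix_matrix_mult_def suminf_matrix_component[OF summable_norm_cancel[OF a]]
        suminf_matrix_component[OF summable_norm_cancel[OF b]])
  finally show "(\<lambda>n. (\<Sum>k<n. \<Sum>i\<le>k. a i ** b (k - i)) $ x $ y) \<longlonglongrightarrow> (suminf a ** suminf b) $ x $ y"
    by (simp add: sums_def)
qed

section \<open>Powers, exponentials and conjugation by exponentials\<close>

abbreviation matrix_power :: "complex ^ 'a ^ 'a \<Rightarrow> nat \<Rightarrow> complex ^ 'a ^ 'a"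
  where "matrix_power A k \<equiv> ((\<lambda>B. A ** B) ^^ k) (mat 1)"

lemma matrix_power_commute: "matrix_power A k ** A = A ** matrix_power A k"
  by (induction k) (simp_all add: matrix_mul_assoc[symmetric])

lemma dagger_matrix_power: "dagger (matrix_power A k) = matrix_power (dagger A) k"
  by (induction k) (simp_all add: dagger_mult matrix_power_commute)

lemma summable_norm_matrix_exp:
  "summable (\<lambda>k. norm (matrix_power (A :: complex ^ 'a::finite ^ 'a) k /\<^sub>R fact k))"
  by (rule summable_norm_exp_series[OF linear_matrix_mult_left])

text \<open>The adjoint is only conjugate linear over the complex numbers, but it is real linear and
  the series has real coefficients.\<close>

lemma dagger_matrix_exp: "dagger (matrix_exp (A :: complex ^ 'a::finite ^ 'a)) = matrix_exp (dagger A)"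
proof -
  have "bounded_linear (dagger :: complex ^ 'a ^ 'a \<Rightarrow> _)"
    using linear_dagger by (simp add: linear_conv_bounded_linear)
  from bounded_linear.suminf[OF this summable_norm_cancel[OF summable_norm_matrix_exp]]
  show ?thesis
    by (simp add: matrix_exp_def linear_cmul[OF linear_dagger] dagger_matrix_power)
qed

text \<open>
  With \<open>D = (\<lambda>X. A ** X - X ** B)\<close>, left multiplication by \<open>A\<close> is the sum of \<open>D\<close> and right
  multiplication by \<open>B\<close>, which commute; this is the identity \<open>exp (D + R) = exp D \<circ> exp R\<close> at \<open>X\<close>.
\<close>

lemma matrix_exp_intertwine:
  fixes A B X :: "complex ^ 'a::finite ^ 'a"
  defines "D \<equiv> \<lambda>X. A ** X - X ** B"
  shows "matrix_exp A ** X = (\<Sum>k. (D ^^ k) X /\<^sub>R fact k) ** matrix_exp B"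
proof -
  define x where "x k = (D ^^ k) X /\<^sub>R fact k" for k
  define b where "b k = matrix_power B k /\<^sub>R fact k" for k
  define S where "S k = (\<Sum>i\<le>k. x i ** b (k - i))" for k
  have linD: "linear D"
    unfolding D_def by (intro linear_compose_sub linear_matrix_mult_left linear_matrix_mult_right)
  have x_Suc: "real (Suc k) *\<^sub>R x (Suc k) = A ** x k - x k ** B" for k
    by (simp add: x_def D_def scaleR_conv_cscale mult_cscale cscale_simps field_simps del: of_nat_Suc)
  have b_Suc: "real (Suc k) *\<^sub>R b (Suc k) = B ** b k" for k
    by (simp add: b_def scaleR_conv_cscale mult_cscale cscale_simps field_simps del: of_nat_Suc)
  \<comment> \<open>Split the factor k + 1 as i + (k + 1 - i). The first part lowers the index of
    \<open>x\<close>, the second that of \<open>b\<close>, and the terms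
    \<open>x i ** B ** b (k - i)\<close> cancel. The boundary terms i = 0 and i = k + 1 have
    coefficient zero.\<close>
  have S_Suc: "real (Suc k) *\<^sub>R S (Suc k) = A ** S k" for k
  proof -
    have "real (Suc k) *\<^sub>R S (Suc k) =
        (\<Sum>i\<le>Suc k. real i *\<^sub>R (x i ** b (Suc k - i))) +
        (\<Sum>i\<le>Suc k. real (Suc k - i) *\<^sub>R (x i ** b (Suc k - i)))"
      unfolding S_def scaleR_sum_right sum.distrib[symmetric]
      by (intro sum.cong refl) (simp add: scaleR_left_distrib[symmetric] del: of_nat_Suc)
    also have "(\<Sum>i\<le>Suc k. real i *\<^sub>R (x i ** b (Suc k - i))) =
        (\<Sum>i\<le>k. (A ** x i - x i ** B) ** b (k - i))"
      by (subst sum.atMost_Suc_shift)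
         (simp add: x_Suc[symmetric] scaleR_conv_cscale mult_cscale cscale_simps del: of_nat_Suc)
    also have "(\<Sum>i\<le>Suc k. real (Suc k - i) *\<^sub>R (x i ** b (Suc k - i))) =
        (\<Sum>i\<le>k. x i ** (B ** b (k - i)))"
      by (simp add: Suc_diff_le b_Suc[symmetric] scaleR_conv_cscale mult_cscale cscale_simps
          del: of_nat_Suc of_nat_diff)
    also have "(\<Sum>i\<le>k. (A ** x i - x i ** B) ** b (k - i)) + \<dots> = A ** S k"
      by (simp add: S_def linear_sum[OF linear_matrix_mult_left] matrix_distribs matrix_mul_assoc
          sum.distrib[symmetric])
    finally show ?thesis .
  qed
  \<comment> \<open>The recurrence together with \<open>S 0 = X\<close> determines \<open>S\<close>.
    The same sequence is thus a Cauchy product and the exponential series of \<open>A\<close> times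
    \<open>X\<close>; comparing the two sums gives the claim.\<close>
  have S_eq: "S = (\<lambda>k. (matrix_power A k /\<^sub>R fact k) ** X)"
  proof
    show "S k = (matrix_power A k /\<^sub>R fact k) ** X" for k
    proof (induction k)
      case 0
      show ?case by (simp add: S_def x_def b_def)
    next
      case (Suc k)
      have "S (Suc k) = (A ** S k) /\<^sub>R real (Suc k)"
        using S_Suc[of k] by (metis of_nat_neq_0 scaleR_one scaleR_scaleR left_inverse)
      then show ?case
        by (simp add: Suc scaleR_conv_cscale mult_cscale cscale_simps matrix_mul_assoc mult.commute)
    qed
  qed
  have "S sums (suminf x ** suminf b)"
    unfolding S_def x_def b_def
    by (intro matrix_Cauchy_product summable_norm_matrix_exp summable_norm_exp_series linD)
  moreover have "S sums (matrix_exp A ** X)"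
  proof -
    have "(\<lambda>k. matrix_power A k /\<^sub>R fact k) sums matrix_exp A"
      unfolding matrix_exp_def by (intro summable_sums summable_norm_cancel[OF summable_norm_matrix_exp])
    from bounded_linear.sums[OF bounded_bilinear.bounded_linear_left[OF bounded_bilinear_matrix_mult] this, of X]
    show ?thesis by (simp only: S_eq)
  qed
  ultimately show ?thesis
    unfolding x_def b_def matrix_exp_def using sums_unique2 by blast
qed

text \<open>Intertwining with 0 on the left, \<open>A\<close> on the right and
  \<open>X = mat 1\<close>: the difference map is then right multiplication by \<open>- A\<close>,
  whose exponential series at \<open>mat 1\<close> is \<open>matrix_exp (- A)\<close>.\<close>

lemma matrix_exp_minus: "matrix_exp (- A) ** matrix_exp A = mat 1"
  for A :: "complex ^ 'a::finite ^ 'a"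
proof -
  have exp_0: "matrix_exp (0 :: complex ^ 'a ^ 'a) = mat 1"
  proof -
    have "matrix_power (0 :: complex ^ 'a ^ 'a) k /\<^sub>R fact k = 0" if "k \<notin> {0}" for k
      using that by (cases k) (simp_all add: vec_eq_iff matrix_matrix_mult_def)
    then have "(\<Sum>k. matrix_power (0 :: complex ^ 'a ^ 'a) k /\<^sub>R fact k) =
        (\<Sum>k\<in>{0}. matrix_power 0 k /\<^sub>R fact k)"
      by (intro suminf_finite) blast+
    then show ?thesis
      by (simp add: matrix_exp_def)
  qed
  have power: "((\<lambda>X. 0 ** X - X ** A) ^^ k) (mat 1) = matrix_power (- A) k" for k
  proof (induction k)
    case (Suc k)
    have "(0 :: complex ^ 'a ^ 'a) ** X - X ** A = X ** (- A)" for X :: "complex ^ 'a ^ 'a"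
      by (simp add: vec_eq_iff matrix_matrix_mult_def sum_negf)
    with Suc show ?case by (simp add: matrix_power_commute)
  qed simp
  show ?thesis
    using matrix_exp_intertwine[of 0 "mat 1" A]
    unfolding power exp_0 matrix_exp_def[of "- A", symmetric] matrix_mul_rid by (rule sym)
qed

text \<open>This is Ad (exp A) = exp (ad A), the intertwining identity with the same matrix on both
  sides.\<close>

lemma matrix_exp_conjugate:
  fixes A X :: "complex ^ 'a::finite ^ 'a"
  shows "matrix_exp A ** X ** matrix_exp (- A) = (\<Sum>k. (commutator A ^^ k) X /\<^sub>R fact k)"
proof -
  have "matrix_exp A ** matrix_exp (- A) = mat 1"
    using matrix_exp_minus[of "- A"] by simp
  moreover have "commutator A = (\<lambda>X. A ** X - X ** A)"
    by (simp add: commutator_def fun_eq_iff)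
  ultimately show ?thesis
    by (simp add: matrix_exp_intertwine[of A X A] matrix_mul_assoc[symmetric])
qed

text \<open>Passes from invariance under a Lie algebra element to invariance under its exponential:
  the partial sums of exp (ad A) stay in \<open>S\<close>, and a subspace in finite dimension is
  closed.\<close>

lemma matrix_exp_conjugate_mem:
  fixes A X :: "complex ^ 'a::finite ^ 'a"
  assumes "subspace S" "\<And>Y. Y \<in> S \<Longrightarrow> commutator A Y \<in> S" "X \<in> S"
  shows "matrix_exp A ** X ** matrix_exp (- A) \<in> S"
proof -
  have "linear (commutator A)"
    unfolding commutator_def
    by (intro linear_compose_sub linear_matrix_mult_left linear_matrix_mult_right)
  then have sm: "summable (\<lambda>k. (commutator A ^^ k) X /\<^sub>R fact k)"
    by (intro summable_norm_cancel[OF summable_norm_exp_series])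
  have "(commutator A ^^ k) X \<in> S" for k
    by (induction k) (use assms in auto)
  then have "(\<Sum>k<n. (commutator A ^^ k) X /\<^sub>R fact k) \<in> S" for n
    by (intro subspace_sum subspace_scale assms)
  moreover have "closed S"
    using assms by (simp add: closed_subspace)
  ultimately show ?thesis
    unfolding matrix_exp_conjugate
    using closed_sequentially[OF _ _ summable_LIMSEQ[OF sm]] by simp
qed

text \<open>The matrices (1 + g) / 2 and (1 - g) / 2 are the spectral projections of
  \<open>g\<close> for the eigenvalues 1 and -1; \<open>c *\<^sub>c g\<close> acts on their ranges
  as \<open>c\<close> and \<open>- c\<close>.\<close>

lemma matrix_exp_involution:
  fixes g :: "complex ^ 'a::finite ^ 'a"
  assumes "g ** g = mat 1"
  shows "matrix_exp (c *\<^sub>c g) = (exp c / 2) *\<^sub>c (mat 1 + g) + (exp (- c) / 2) *\<^sub>c (mat 1 - g)"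
proof -
  have power: "matrix_power (c *\<^sub>c g) k = (c ^ k / 2) *\<^sub>c (mat 1 + g) + ((- c) ^ k / 2) *\<^sub>c (mat 1 - g)" for k
  proof (induction k)
    case 0
    show ?case by (simp add: cscale_def vec_eq_iff field_simps)
  next
    case (Suc k)
    then show ?case
      by (simp add: matrix_distribs mult_cscale assms)
         (simp add: cscale_def vec_eq_iff field_simps)
  qed
  have exp: "(\<lambda>k. (a ^ k /\<^sub>R fact k / 2) *\<^sub>c B) sums ((exp a / 2) *\<^sub>c B)" for a and B :: "complex ^ 'a ^ 'a"
  proof -
    have "bounded_linear (\<lambda>c. (c / 2) *\<^sub>c B)"
      unfolding linear_conv_bounded_linear[symmetric]
      by (rule linear_compose[OF _ linear_cscale_left, unfolded o_def])
         (rule linearI; simp add: add_divide_distrib)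
    from bounded_linear.sums[OF this exp_converges[of a]] show ?thesis .
  qed
  have "(\<lambda>k. matrix_power (c *\<^sub>c g) k /\<^sub>R fact k) sums
      ((exp c / 2) *\<^sub>c (mat 1 + g) + (exp (- c) / 2) *\<^sub>c (mat 1 - g))"
    using sums_add[OF exp[of c "mat 1 + g"] exp[of "- c" "mat 1 - g"]]
    by (simp add: power scaleR_right_distrib) (simp add: scaleR_conv_cscale cscale_simps scaleR_conv_of_real)
  then show ?thesis
    unfolding matrix_exp_def by (simp add: sums_iff)
qed

section \<open>Pauli strings\<close>

definition kronecker :: "('n::finite \<Rightarrow> complex ^ 2 ^ 2) \<Rightarrow> 'n operator"
  where "kronecker A = (\<chi> x y. \<Prod>i\<in>UNIV. A i $ x i $ y i)"

text \<open>Distributivity: one summand for each choice function \<open>z\<close>. With two-element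
  sums these functions are the basis labels, so products and traces of Kronecker products can be
  computed factor by factor.\<close>

lemma prod_sum_fun:
  fixes f :: "'n::finite \<Rightarrow> 'b::finite \<Rightarrow> 'c::comm_semiring_1"
  shows "(\<Prod>i\<in>UNIV. \<Sum>j\<in>UNIV. f i j) = (\<Sum>z\<in>UNIV. \<Prod>i\<in>UNIV. f i (z i))"
  using prod_sum_PiE[of UNIV "\<lambda>_. UNIV" f] by (simp add: PiE_UNIV_domain)

lemma kronecker_mult: "kronecker A ** kronecker B = kronecker (\<lambda>i. A i ** B i)"
  by (simp add: kronecker_def matrix_matrix_mult_def vec_eq_iff prod_sum_fun prod.distrib)

lemma kronecker_cscale: "kronecker (\<lambda>i. c i *\<^sub>c A i) = (\<Prod>i\<in>UNIV. c i) *\<^sub>c kronecker A"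
  by (simp add: kronecker_def cscale_def vec_eq_iff prod.distrib)

lemma kronecker_mat_1: "kronecker (\<lambda>i. mat 1) = mat 1"
  by (auto simp: kronecker_def mat_def vec_eq_iff fun_eq_iff)

lemma trace_kronecker: "trace (kronecker A) = (\<Prod>i\<in>UNIV. trace (A i))"
  by (simp add: kronecker_def trace_def prod_sum_fun)

lemma dagger_kronecker: "dagger (kronecker A) = kronecker (\<lambda>i. dagger (A i))"
  by (simp add: kronecker_def dagger_def vec_eq_iff)

lemma pauli_string_kronecker: "pauli_string \<sigma> = kronecker (\<lambda>i. pauli_matrix (\<sigma> i))"
  by (simp add: pauli_string_def kronecker_def)

section \<open>The four Pauli matrices\<close>

lemmas pauli_matrix_simps = vec_eq_iff matrix_matrix_mult_def mat_def dagger_def cscale_def trace_def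
  sum_2 forall_2

lemma pauli_matrix_square: "pauli_matrix s ** pauli_matrix s = mat 1"
  by (cases s) (simp_all add: pauli_matrix_simps)

lemma dagger_pauli_matrix: "dagger (pauli_matrix s) = pauli_matrix s"
  by (cases s) (simp_all add: pauli_matrix_simps)

lemma trace_pauli_matrix_mult: "s \<noteq> t \<Longrightarrow> trace (pauli_matrix s ** pauli_matrix t) = 0"
  by (cases s; cases t) (simp_all add: pauli_matrix_simps)

lemma pauli_matrix_mult: "\<exists>c r. pauli_matrix s ** pauli_matrix t = c *\<^sub>c pauli_matrix r"
proof -
  \<comment> \<open>Quantifying over explicit finite sets lets simplification try every candidate in
    each of the sixteen cases.\<close>
  have "\<exists>c\<in>{1, \<i>, - \<i>}. \<exists>r\<in>{PI, PX, PY, PZ}. pauli_matrix s ** pauli_matrix t = c *\<^sub>c pauli_matrix r"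
    by (cases s; cases t) (simp_all add: pauli_matrix_simps)
  then show ?thesis by blast
qed

lemma pauli_matrix_commute:
  "\<exists>e\<in>{1, -1}. pauli_matrix s ** pauli_matrix t = e *\<^sub>c (pauli_matrix t ** pauli_matrix s)"
  by (cases s; cases t) (simp_all add: pauli_matrix_simps)

section \<open>Squares, traces, products and commutation of Pauli strings\<close>

lemma finite_pauli_strings: "finite (pauli_strings :: ('n::finite) operator set)"
proof -
  have "(UNIV :: pauli set) = {PI, PX, PY, PZ}"
    using pauli.exhaust by blast
  then have "finite (UNIV :: pauli set)"
    by (metis finite.emptyI finite.insertI)
  then have "finite (UNIV :: ('n \<Rightarrow> pauli) set)"
    using finite_PiE[of "UNIV :: 'n set" "\<lambda>_. UNIV :: pauli set"] by (simp add: PiE_UNIV_domain)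
  then show ?thesis
    unfolding pauli_strings_def by simp
qed

lemma pauli_square: "p \<in> pauli_strings \<Longrightarrow> p ** p = mat 1"
  by (auto simp: pauli_strings_def pauli_string_kronecker kronecker_mult pauli_matrix_square kronecker_mat_1)

lemma dagger_pauli: "p \<in> pauli_strings \<Longrightarrow> dagger p = p"
  by (auto simp: pauli_strings_def pauli_string_kronecker dagger_kronecker dagger_pauli_matrix)

text \<open>The trace factors over the qubits, and a qubit where the strings differ contributes a
  zero factor.\<close>

lemma trace_pauli_mult:
  assumes "p \<in> pauli_strings" "q \<in> pauli_strings" "p \<noteq> q"
  shows "trace (p ** q) = 0"
proof -
  obtain \<sigma> \<tau> where pq: "p = pauli_string \<sigma>" "q = pauli_string \<tau>"
    using assms by (auto simp: pauli_strings_def)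
  with assms obtain i where "\<sigma> i \<noteq> \<tau> i"
    by (metis ext)
  then show ?thesis
    by (auto simp: pq pauli_string_kronecker kronecker_mult trace_kronecker
        intro!: prod_zero bexI[of _ i] trace_pauli_matrix_mult)
qed

lemma pauli_mult:
  assumes "p \<in> pauli_strings" "q \<in> pauli_strings"
  shows "\<exists>c. \<exists>r\<in>pauli_strings. p ** q = c *\<^sub>c r"
proof -
  obtain \<sigma> \<tau> where pq: "p = pauli_string \<sigma>" "q = pauli_string \<tau>"
    using assms by (auto simp: pauli_strings_def)
  have "\<forall>i. \<exists>c r. pauli_matrix (\<sigma> i) ** pauli_matrix (\<tau> i) = c *\<^sub>c pauli_matrix r"
    using pauli_matrix_mult by blast
  then obtain c \<rho> where "\<And>i. pauli_matrix (\<sigma> i) ** pauli_matrix (\<tau> i) = c i *\<^sub>c pauli_matrix (\<rho> i)"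
    unfolding choice_iff by blast
  then have "p ** q = (\<Prod>i\<in>UNIV. c i) *\<^sub>c pauli_string \<rho>"
    by (simp add: pq pauli_string_kronecker kronecker_mult kronecker_cscale)
  then show ?thesis
    by (auto simp: pauli_strings_def)
qed

text \<open>Each qubit contributes a sign, and a product of signs is a sign.\<close>

lemma pauli_commute:
  assumes "p \<in> pauli_strings" "q \<in> pauli_strings"
  shows "p ** q = q ** p \<or> p ** q = - (q ** p)"
proof -
  obtain \<sigma> \<tau> where pq: "p = pauli_string \<sigma>" "q = pauli_string \<tau>"
    using assms by (auto simp: pauli_strings_def)
  have "\<forall>i. \<exists>e. e \<in> {1, -1} \<and>
      pauli_matrix (\<sigma> i) ** pauli_matrix (\<tau> i) = e *\<^sub>c (pauli_matrix (\<tau> i) ** pauli_matrix (\<sigma> i))"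
    using pauli_matrix_commute by blast
  then obtain e where e: "\<And>i. e i \<in> {1, -1 :: complex}"
    "\<And>i. pauli_matrix (\<sigma> i) ** pauli_matrix (\<tau> i) = e i *\<^sub>c (pauli_matrix (\<tau> i) ** pauli_matrix (\<sigma> i))"
    unfolding choice_iff by blast
  have "p ** q = (\<Prod>i\<in>UNIV. e i) *\<^sub>c (q ** p)"
    by (simp add: pq pauli_string_kronecker kronecker_mult kronecker_cscale[symmetric] e(2)[symmetric])
  moreover have "(\<Prod>i\<in>A. e i) \<in> {1, -1}" for A
  proof (induction A rule: infinite_finite_induct)
    case (insert i A)
    then show ?case using e(1)[of i] by auto
  qed auto
  ultimately show ?thesis
    by (metis cscale_simps(2,8) insertE singletonD)
qed

text \<open>Square both expressions: \<open>g ** p\<close> squares to -1 by anticommutation, while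
  \<open>c *\<^sub>c q\<close> squares to c^2.\<close>

lemma pauli_anticommute_mult:
  fixes g p q :: "('n::finite) operator"
  assumes "g \<in> pauli_strings" "p \<in> pauli_strings" "q \<in> pauli_strings"
    and anti: "g ** p = - (p ** g)" and c: "g ** p = c *\<^sub>c q"
  shows "c = \<i> \<or> c = - \<i>"
proof -
  have "c\<^sup>2 *\<^sub>c mat 1 = (g ** p) ** (g ** p)"
    unfolding c using assms(3) by (simp add: mult_cscale cscale_simps pauli_square power2_eq_square)
  also have "\<dots> = (- (p ** g)) ** (g ** p)"
    by (rule arg_cong[OF anti, of "\<lambda>X. X ** (g ** p)"])
  also have "\<dots> = (-1) *\<^sub>c ((p ** g) ** (g ** p))"
    using cscale_simps(8)[of 1 "p ** g"] by (simp only: cscale_simps(2) mult_cscale)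
  also have "(p ** g) ** (g ** p) = p ** (g ** g) ** p"
    by (simp only: matrix_mul_assoc)
  also have "\<dots> = mat 1"
    using assms by (simp add: pauli_square)
  \<comment> \<open>Any diagonal entry of the identity will do; \<open>undefined\<close> picks
    one.\<close>
  finally have "(c\<^sup>2 *\<^sub>c mat 1 :: 'n operator) $ undefined $ undefined = ((-1) *\<^sub>c mat 1 :: 'n operator) $ undefined $ undefined"
    by simp
  then have "c\<^sup>2 = - 1"
    by (simp add: cscale_def mat_def)
  then show ?thesis
    by (metis i_squared power2_eq_square square_eq_iff)
qed

section \<open>Expansion in Pauli strings\<close>

text \<open>The Hilbert-Schmidt inner product, normalized by the dimension so that Pauli strings are
  orthonormal; no adjoint appears because they are self-adjoint.\<close>

definition pauli_coeff :: "('n::finite) operator \<Rightarrow> 'n operator \<Rightarrow> complex"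
  where "pauli_coeff q A = trace (q ** A) / of_nat CARD('n \<Rightarrow> 2)"

lemma linear_pauli_coeff: "linear (pauli_coeff q)"
  by (rule linearI)
     (simp_all add: pauli_coeff_def matrix_distribs trace_add add_divide_distrib scaleR_conv_cscale
       mult_cscale trace_cscale scaleR_conv_of_real)

lemma pauli_coeff_cscale: "pauli_coeff q (c *\<^sub>c A) = c * pauli_coeff q A"
  by (simp add: pauli_coeff_def mult_cscale trace_cscale)

lemma pauli_coeff_pauli:
  assumes "q \<in> pauli_strings" "r \<in> pauli_strings"
  shows "pauli_coeff q r = (if q = r then 1 else 0)"
proof (cases "q = r")
  case True
  with assms show ?thesis by (simp add: pauli_coeff_def pauli_square trace_def mat_def)
next
  case False
  with assms show ?thesis by (simp add: pauli_coeff_def trace_pauli_mult)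
qed

text \<open>Cyclicity of the trace. It turns a sum over the conjugated string \<open>p\<close> into
  a sum over the coefficients of one fixed operator, to which Parseval applies.\<close>

lemma pauli_coeff_conjugate:
  fixes p q U :: "('n::finite) operator"
  shows "pauli_coeff q (dagger U ** p ** U) = pauli_coeff p (U ** q ** dagger U)"
proof -
  have "trace (q ** (dagger U ** p ** U)) = trace ((q ** dagger U) ** (p ** U))"
    by (simp only: matrix_mul_assoc)
  also have "\<dots> = trace (p ** (U ** q ** dagger U))"
    by (subst trace_mul_sym) (simp only: matrix_mul_assoc)
  finally show ?thesis
    by (simp add: pauli_coeff_def)
qed

lemma pauli_coeff_sum:
  assumes "S \<subseteq> pauli_strings" "q \<in> S"
  shows "pauli_coeff q (\<Sum>r\<in>S. c r *\<^sub>c r) = c q"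
proof -
  have "finite S"
    using assms finite_pauli_strings finite_subset by blast
  have "pauli_coeff q (\<Sum>r\<in>S. c r *\<^sub>c r) = (\<Sum>r\<in>S. if q = r then c r else 0)"
    unfolding linear_sum[OF linear_pauli_coeff]
    by (rule sum.cong) (use assms in \<open>auto simp: pauli_coeff_cscale pauli_coeff_pauli subset_eq\<close>)
  also have "\<dots> = c q"
    using \<open>finite S\<close> assms by simp
  finally show ?thesis .
qed

text \<open>Here \<open>span\<close> is the real span, hence real coefficients; these turn the trace
  of a square into a sum of squares of moduli.\<close>

lemma span_pauli_expansion:
  assumes "S \<subseteq> pauli_strings" "A \<in> span S"
  shows "\<exists>u :: _ \<Rightarrow> real. A = (\<Sum>r\<in>S. complex_of_real (u r) *\<^sub>c r)"
proof -
  have "finite S"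
    using assms finite_pauli_strings finite_subset by blast
  then show ?thesis
    using assms(2) by (auto simp: span_finite scaleR_conv_cscale)
qed

lemma expansion_coeff_eq:
  assumes S: "S \<subseteq> pauli_strings" and A: "A \<in> span S" and q: "q \<in> S"
  shows "expansion_coeff S A q = pauli_coeff q A"
proof -
  obtain u :: "_ \<Rightarrow> real" where u: "A = (\<Sum>r\<in>S. complex_of_real (u r) *\<^sub>c r)"
    using span_pauli_expansion[OF S A] by blast
  have "expansion_coeff S A = (\<lambda>r. if r \<in> S then pauli_coeff r A else 0)"
    unfolding expansion_coeff_def
  \<comment> \<open>Existence and uniqueness under \<open>THE\<close> both hold because the trace
    pairing recovers every coefficient of a combination of strings from \<open>S\<close>.\<close>
  proof (rule the_equality)
    have "(\<Sum>r\<in>S. (if r \<in> S then pauli_coeff r A else 0) *\<^sub>c r) = (\<Sum>r\<in>S. complex_of_real (u r) *\<^sub>c r)"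
      by (rule sum.cong) (use pauli_coeff_sum[OF S] in \<open>auto simp: u\<close>)
    then show "A = (\<Sum>r\<in>S. (if r \<in> S then pauli_coeff r A else 0) *\<^sub>c r) \<and>
        (\<forall>r. r \<notin> S \<longrightarrow> (if r \<in> S then pauli_coeff r A else 0) = 0)"
      using u by simp
  next
    fix c assume c: "A = (\<Sum>r\<in>S. c r *\<^sub>c r) \<and> (\<forall>r. r \<notin> S \<longrightarrow> c r = 0)"
    show "c = (\<lambda>r. if r \<in> S then pauli_coeff r A else 0)"
    proof
      fix r
      show "c r = (if r \<in> S then pauli_coeff r A else 0)"
        using pauli_coeff_sum[OF S, of r c] c by auto
    qed
  qed
  with q show ?thesis by simp
qed

text \<open>The normalized trace of \<open>A ** A\<close> is 1; expanding one factor over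
  \<open>S\<close> with real coefficients gives the sum of their squares.\<close>

lemma pauli_Parseval:
  assumes S: "S \<subseteq> pauli_strings" and A: "A \<in> span S" and A2: "A ** A = mat 1"
  shows "(\<Sum>q\<in>S. (cmod (pauli_coeff q A))\<^sup>2) = 1"
proof -
  obtain u :: "_ \<Rightarrow> real" where u: "A = (\<Sum>r\<in>S. complex_of_real (u r) *\<^sub>c r)"
    using span_pauli_expansion[OF S A] by blast
  have u_coeff: "pauli_coeff q A = of_real (u q)" if "q \<in> S" for q
    using pauli_coeff_sum[OF S that] u by simp
  have "1 = pauli_coeff A A"
    by (simp add: pauli_coeff_def A2 trace_def mat_def)
  also have "\<dots> = (\<Sum>q\<in>S. of_real (u q) * pauli_coeff q A)"
    by (subst u)
       (simp add: pauli_coeff_def linear_sum[OF linear_matrix_mult_right] linear_sum[OF linear_trace]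
         mult_cscale trace_cscale sum_divide_distrib)
  also have "\<dots> = of_real (\<Sum>q\<in>S. (u q)\<^sup>2)"
    by (simp add: u_coeff power2_eq_square)
  finally have "(\<Sum>q\<in>S. (u q)\<^sup>2) = 1"
    by (metis of_real_eq_1_iff)
  then show ?thesis
    by (simp add: u_coeff)
qed

section \<open>Conjugation by the generated group\<close>

text \<open>A nonzero commutator forces anticommutation, and then it is twice the product. So an
  edge makes \<open>g ** p\<close> a multiple of \<open>q\<close>, with a factor \<i> or
  -\<i>.\<close>

lemma commutator_graph_edgeE:
  fixes \<G> :: "('n::finite) operator set"
  assumes "\<G> \<subseteq> pauli_strings" "(p, q) \<in> commutator_graph \<G>"
  obtains g c where "g \<in> \<G>" "g ** p = - (p ** g)" "g ** p = c *\<^sub>c q" "cmod c = 1"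
proof -
  obtain g c where g: "g \<in> \<G>" "p \<in> pauli_strings" "q \<in> pauli_strings" "c \<noteq> 0" "commutator g p = c *\<^sub>c q"
    using assms(2) by (auto simp: commutator_graph_def)
  have "q \<noteq> 0"
  proof
    assume "q = 0"
    then have "(mat 1 :: 'n operator) $ undefined $ undefined = 0"
      using pauli_square[OF g(3)] by simp
    then show False
      by (simp add: mat_def)
  qed
  then have "commutator g p \<noteq> 0"
    using g by (auto simp: cscale_def vec_eq_iff)
  then have anti: "g ** p = - (p ** g)"
    using pauli_commute[of g p] g assms(1) by (auto simp: commutator_def)
  then have "commutator g p = 2 *\<^sub>c (g ** p)"
    by (simp add: commutator_def cscale_def vec_eq_iff)
  then have "g ** p = (c / 2) *\<^sub>c q"
    using g(5) by (simp add: cscale_def vec_eq_iff field_simps)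
  moreover from this have "c / 2 = \<i> \<or> c / 2 = - \<i>"
    using pauli_anticommute_mult[OF _ g(2,3) anti] g(1) assms(1) by blast
  then have "cmod (c / 2) = 1"
    by (metis norm_ii norm_minus_cancel)
  ultimately show ?thesis
    using that[OF g(1) anti] by blast
qed

lemma graph_component_subset:
  assumes "p \<in> pauli_strings"
  shows "graph_component \<G> p \<subseteq> pauli_strings"
proof
  fix q assume "q \<in> graph_component \<G> p"
  then have "(p, q) \<in> (commutator_graph \<G>)\<^sup>*" by (simp add: graph_component_def)
  then show "q \<in> pauli_strings"
    by induction (use assms in \<open>auto simp: commutator_graph_def\<close>)
qed

text \<open>On a string of the component the commutator is zero or 2 or -2 times a neighbour; the
  \<i> in the generator makes that factor real, as the real span requires.\<close>

lemma generator_preserves_component_span: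
  assumes \<G>: "\<G> \<subseteq> pauli_strings" and p: "p \<in> pauli_strings" and g: "g \<in> \<G>"
    and X: "X \<in> span (graph_component \<G> p)"
  shows "commutator (\<i> *\<^sub>c g) X \<in> span (graph_component \<G> p)"
proof -
  let ?C = "graph_component \<G> p"
  have lin: "linear (commutator (\<i> *\<^sub>c g))"
    unfolding commutator_def
    by (intro linear_compose_sub linear_matrix_mult_left linear_matrix_mult_right)
  have "commutator (\<i> *\<^sub>c g) q \<in> span ?C" if q: "q \<in> ?C" for q
  proof (cases "g ** q = q ** g")
    case True
    then show ?thesis by (simp add: commutator_def mult_cscale span_zero)
  next
    case False
    have gq: "g \<in> pauli_strings" "q \<in> pauli_strings"
      using \<G> g graph_component_subset[OF p] q by blast+
    with False have anti: "g ** q = - (q ** g)"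
      using pauli_commute by blast
    obtain c r where r: "r \<in> pauli_strings" "g ** q = c *\<^sub>c r"
      using pauli_mult[OF gq] by blast
    have c: "c = \<i> \<or> c = - \<i>"
      using pauli_anticommute_mult[OF gq r(1) anti r(2)] .
    have comm: "commutator g q = (2 * c) *\<^sub>c r"
      using anti r(2) by (simp add: commutator_def cscale_def vec_eq_iff)
    have "2 * c \<noteq> 0"
      using c by auto
    with comm have "(q, r) \<in> commutator_graph \<G>"
      unfolding commutator_graph_def using gq(2) r(1) g by blast
    then have "r \<in> ?C"
      using q by (auto simp: graph_component_def)
    then have r_span: "k *\<^sub>R r \<in> span ?C" for k
      by (intro span_scale span_base)
    have "commutator (\<i> *\<^sub>c g) q = \<i> *\<^sub>c commutator g q"
      by (simp add: commutator_def mult_cscale cscale_simps)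
    moreover have ii: "\<i> * (2 * \<i>) = - 2"
      by (simp add: complex_eq_iff)
    ultimately have "commutator (\<i> *\<^sub>c g) q = (if c = \<i> then - 2 else 2) *\<^sub>R r"
      using comm c by (auto simp: scaleR_conv_cscale cscale_simps ii)
    then show ?thesis
      using r_span by simp
  qed
  then have "span (commutator (\<i> *\<^sub>c g) ` ?C) \<subseteq> span ?C"
    by (intro span_minimal) auto
  with X show ?thesis
    by (auto simp: linear_span_image[OF lin])
qed

section \<open>From the generators to the Lie algebra and its exponentials\<close>

lemma commutator_distribs:
  "commutator (A + B) X = commutator A X + commutator B X"
  "commutator (c *\<^sub>R A) X = c *\<^sub>R commutator A X"
  by (simp_all add: commutator_def matrix_distribs scaleR_conv_cscale mult_cscale cscale_simps)

lemma commutator_Jacobi: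
  "commutator (commutator A B) X = commutator A (commutator B X) - commutator B (commutator A X)"
  by (simp add: commutator_def matrix_distribs matrix_mul_assoc)

lemma generated_lie_algebra_subset:
  assumes "real_lie_algebra L" "\<And>g. g \<in> \<G> \<Longrightarrow> \<i> *\<^sub>c g \<in> L"
  shows "generated_lie_algebra \<G> \<subseteq> L"
  unfolding generated_lie_algebra_def using assms by (intro hull_minimal) auto

text \<open>The hull is an intersection, so membership is checked in each real Lie algebra
  containing the generators.\<close>

lemma scaleR_generator_mem:
  assumes "g \<in> \<G>"
  shows "(complex_of_real r * \<i>) *\<^sub>c g \<in> generated_lie_algebra \<G>"
proof -
  have "r *\<^sub>R (\<i> *\<^sub>c g) \<in> L" if "real_lie_algebra L" "(\<lambda>p. \<i> *\<^sub>c p) ` \<G> \<subseteq> L" for L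
    using that assms by (auto simp: real_lie_algebra_def intro: subspace_scale)
  then show ?thesis
    by (auto simp: generated_lie_algebra_def hull_def scaleR_conv_cscale cscale_simps)
qed

text \<open>The antihermitian matrices form a real Lie algebra, and it contains \<i> times each
  Hermitian generator.\<close>

lemma generated_lie_algebra_antihermitian:
  assumes \<G>: "\<G> \<subseteq> pauli_strings" and A: "A \<in> generated_lie_algebra \<G>"
  shows "dagger A = - A"
proof -
  have "dagger (commutator A B) = - commutator A B" if "dagger A = - A" "dagger B = - B"
    for A B :: "complex ^ 'b ^ 'b"
    using that by (simp add: commutator_def dagger_diff dagger_mult)
      (simp add: vec_eq_iff matrix_matrix_mult_def sum_negf)
  then have "real_lie_algebra {A. dagger A = - A}"
    unfolding real_lie_algebra_def
    by (auto intro!: subspaceI simp: dagger_add linear_cmul[OF linear_dagger] linear_0[OF linear_dagger])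
  moreover have "dagger (\<i> *\<^sub>c g) = - (\<i> *\<^sub>c g)" if "g \<in> \<G>" for g
    using \<G> that by (auto simp: dagger_cscale dagger_pauli subset_eq cscale_simps)
  ultimately show ?thesis
    using generated_lie_algebra_subset[of "{A. dagger A = - A}" \<G>] A by blast
qed

text \<open>By the Jacobi identity, the matrices whose commutator preserves a given subspace form a
  real Lie algebra; it contains the generators.\<close>

lemma generated_lie_algebra_preserves_component_span:
  assumes \<G>: "\<G> \<subseteq> pauli_strings" and p: "p \<in> pauli_strings" and A: "A \<in> generated_lie_algebra \<G>"
    and X: "X \<in> span (graph_component \<G> p)"
  shows "commutator A X \<in> span (graph_component \<G> p)"
proof -
  let ?S = "span (graph_component \<G> p)"
  have "subspace {A. \<forall>X\<in>?S. commutator A X \<in> ?S}"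
  proof (rule subspaceI)
    have "commutator 0 X = 0 *\<^sub>R commutator 0 X" for X :: "'a operator"
      using commutator_distribs(2)[of 0 0 X] by simp
    then show "0 \<in> {A. \<forall>X\<in>?S. commutator A X \<in> ?S}"
      by (simp add: span_zero)
  qed (auto simp: commutator_distribs intro: span_add span_scale)
  then have "real_lie_algebra {A. \<forall>X\<in>?S. commutator A X \<in> ?S}"
    by (auto simp: real_lie_algebra_def commutator_Jacobi intro!: span_diff)
  then have "generated_lie_algebra \<G> \<subseteq> {A. \<forall>X\<in>?S. commutator A X \<in> ?S}"
    by (rule generated_lie_algebra_subset)
       (use generator_preserves_component_span[OF \<G> p] in blast)
  with A X show ?thesis by blast
qed

lemma generated_lie_group_unitary:
  assumes "\<G> \<subseteq> pauli_strings" "U \<in> generated_lie_group \<G>"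
  shows "dagger U ** U = mat 1" "U ** dagger U = mat 1"
proof -
  obtain A where "A \<in> generated_lie_algebra \<G>" "U = matrix_exp A"
    using assms(2) by (auto simp: generated_lie_group_def)
  then show "dagger U ** U = mat 1" "U ** dagger U = mat 1"
    using matrix_exp_minus[of A] matrix_exp_minus[of "- A"]
    by (simp_all add: dagger_matrix_exp generated_lie_algebra_antihermitian[OF assms(1)])
qed

lemma conjugate_mem_component_span:
  assumes \<G>: "\<G> \<subseteq> pauli_strings" and p: "p \<in> pauli_strings" and U: "U \<in> generated_lie_group \<G>"
    and X: "X \<in> span (graph_component \<G> p)"
  shows "U ** X ** dagger U \<in> span (graph_component \<G> p)" "dagger U ** X ** U \<in> span (graph_component \<G> p)"
proof -
  let ?S = "span (graph_component \<G> p)"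
  obtain A where A: "A \<in> generated_lie_algebra \<G>" "U = matrix_exp A"
    using U by (auto simp: generated_lie_group_def)
  have dU: "dagger (matrix_exp A) = matrix_exp (- A)"
    using A by (simp add: dagger_matrix_exp generated_lie_algebra_antihermitian[OF \<G>])
  have ad: "commutator A Y \<in> ?S" if "Y \<in> ?S" for Y
    using generated_lie_algebra_preserves_component_span[OF \<G> p A(1) that] .
  moreover have "commutator (- A) Y \<in> ?S" if "Y \<in> ?S" for Y
    using span_neg[OF ad[OF that]] commutator_distribs(2)[of "-1" A Y] by simp
  ultimately show "U ** X ** dagger U \<in> ?S" "dagger U ** X ** U \<in> ?S"
    using matrix_exp_conjugate_mem[of ?S A X, OF subspace_span _ X]
      matrix_exp_conjugate_mem[of ?S "- A" X, OF subspace_span _ X]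
    by (simp_all add: dU A(2))
qed

text \<open>Moves a string to a neighbour up to a phase. Membership of the adjoint is included
  because translation invariance is applied with an inverse inside the group.\<close>

lemma generated_lie_group_rotation:
  assumes \<G>: "\<G> \<subseteq> pauli_strings" and g: "g \<in> \<G>" and anti: "g ** p = - (p ** g)"
  obtains V where "V \<in> generated_lie_group \<G>" "dagger V \<in> generated_lie_group \<G>"
    "dagger V ** p ** V = - \<i> *\<^sub>c (g ** p)"
proof
  define A where "A r = (complex_of_real r * \<i>) *\<^sub>c g" for r
  define V where "V = matrix_exp (A (pi / 4))"
  have g2: "g ** g = mat 1" and dg: "dagger g = g"
    using \<G> g by (auto simp: pauli_square dagger_pauli subset_eq)
  have "A r \<in> generated_lie_algebra \<G>" for r
    unfolding A_def by (rule scaleR_generator_mem[OF g])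
  then have mem: "matrix_exp (A r) \<in> generated_lie_group \<G>" for r
    by (auto simp: generated_lie_group_def)
  then show "V \<in> generated_lie_group \<G>"
    by (simp add: V_def)
  have "dagger V = matrix_exp (A (- pi / 4))"
    by (simp add: V_def dagger_matrix_exp A_def dagger_cscale dg)
  then show "dagger V \<in> generated_lie_group \<G>"
    by (simp add: mem)
  define s t where "s = cis (pi / 4)" and "t = cis (- (pi / 4))"
  have st: "s * s = \<i>" "t * t = - \<i>"
    by (simp_all add: s_def t_def cis_mult)
  have cnj: "cnj s = t" "cnj t = s"
    by (simp_all add: s_def t_def cis_cnj)
  \<comment> \<open>These are cos (pi / 4) and i sin (pi / 4). At this angle the identity part of
    \<open>V ** V\<close> is cos (pi / 2) = 0, and \<i> times \<open>g\<close> remains.\<close>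
  define \<alpha> \<beta> where "\<alpha> = (s + t) / 2" and "\<beta> = (s - t) / 2"
  have coeffs: "\<alpha> * \<alpha> + \<beta> * \<beta> = 0" "2 * (\<alpha> * \<beta>) = \<i>" "cnj \<alpha> = \<alpha>" "cnj \<beta> = - \<beta>"
  proof -
    have "\<alpha> * \<alpha> + \<beta> * \<beta> = (s * s + t * t) / 2" "2 * (\<alpha> * \<beta>) = (s * s - t * t) / 2"
      by (simp_all add: \<alpha>_def \<beta>_def field_simps)
    then show "\<alpha> * \<alpha> + \<beta> * \<beta> = 0" "2 * (\<alpha> * \<beta>) = \<i>"
      by (simp_all add: st)
    show "cnj \<alpha> = \<alpha>" "cnj \<beta> = - \<beta>"
      by (simp_all add: \<alpha>_def \<beta>_def cnj add.commute diff_divide_distrib)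
  qed
  have V: "V = \<alpha> *\<^sub>c mat 1 + \<beta> *\<^sub>c g"
    using matrix_exp_involution[OF g2, of "complex_of_real (pi / 4) * \<i>"]
    by (simp add: V_def A_def \<alpha>_def \<beta>_def s_def t_def cis_conv_exp mult.commute)
       (simp add: cscale_def vec_eq_iff field_simps)
  \<comment> \<open>The adjoint flips the sign of the \<open>g\<close> part of \<open>V\<close>, and
    moving \<open>g\<close> past \<open>p\<close> flips it back.\<close>
  have "dagger V ** p = p ** V"
    by (simp add: V dagger_add dagger_cscale dg coeffs matrix_distribs mult_cscale anti)
       (simp add: cscale_def vec_eq_iff)
  moreover have "V ** V = (\<alpha> * \<alpha> + \<beta> * \<beta>) *\<^sub>c mat 1 + (2 * (\<alpha> * \<beta>)) *\<^sub>c g"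
    by (simp add: V matrix_distribs mult_cscale g2 cscale_simps)
       (simp add: cscale_def vec_eq_iff field_simps)
  ultimately have "dagger V ** p ** V = p ** (\<i> *\<^sub>c g)"
    by (simp add: coeffs cscale_simps matrix_mul_assoc[symmetric])
  also have "\<dots> = - \<i> *\<^sub>c (g ** p)"
    by (simp add: mult_cscale anti) (simp add: cscale_def vec_eq_iff)
  finally show "dagger V ** p ** V = - \<i> *\<^sub>c (g ** p)" .
qed

section \<open>Averaging over the group\<close>

lemma haar_probability_measure_space:
  "haar_probability_measure H \<mu> \<Longrightarrow> space \<mu> = H"
  using sets_eq_imp_space_eq[of \<mu> "restrict_space borel H"]
  by (simp add: haar_probability_measure_def space_restrict_space)

text \<open>Closure is read off the measure: the translate of \<open>H\<close> has measure 1, so it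
  is a measurable set and therefore lies in the space \<open>H\<close>.\<close>

lemma haar_probability_measure_mult_closed:
  assumes haar: "haar_probability_measure H \<mu>" and "V \<in> H" "U \<in> H"
  shows "V ** U \<in> H"
proof -
  interpret prob_space \<mu>
    using haar by (simp add: haar_probability_measure_def)
  note [simp] = haar_probability_measure_space[OF haar]
  have "H \<in> sets \<mu>"
    using sets.top[of \<mu>] by simp
  then have "emeasure \<mu> ((\<lambda>U. V ** U) ` H) = emeasure \<mu> H"
    using haar \<open>V \<in> H\<close> by (auto simp: haar_probability_measure_def)
  also have "\<dots> \<noteq> 0"
    using emeasure_space_1 by simp
  finally have "(\<lambda>U. V ** U) ` H \<in> sets \<mu>"
    using emeasure_notin_sets by blast
  then have "(\<lambda>U. V ** U) ` H \<subseteq> H"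
    using sets.sets_into_space by fastforce
  with \<open>U \<in> H\<close> show ?thesis by blast
qed

lemma haar_integral_left_translate:
  fixes f :: "complex ^ 'a::finite ^ 'a \<Rightarrow> real"
  assumes haar: "haar_probability_measure H \<mu>" and VW: "V \<in> H" "W \<in> H" "V ** W = mat 1" "W ** V = mat 1"
    and f: "f \<in> borel_measurable borel"
  shows "(\<integral>U. f (V ** U) \<partial>\<mu>) = (\<integral>U. f U \<partial>\<mu>)"
proof -
  note [simp] = haar_probability_measure_space[OF haar]
  have sets: "sets \<mu> = sets (restrict_space borel H)"
    using haar by (simp add: haar_probability_measure_def)
  have closed: "X ** U \<in> H" if "X \<in> H" "U \<in> H" for X U
    using haar_probability_measure_mult_closed[OF haar that] .
  have "continuous_on UNIV (\<lambda>U :: complex ^ 'a ^ 'a. V ** U)"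
    by (intro linear_continuous_on linear_matrix_mult_left[unfolded linear_conv_bounded_linear])
  then have "(\<lambda>U. V ** U) \<in> restrict_space borel H \<rightarrow>\<^sub>M restrict_space borel H"
    by (intro measurable_restrict_space3 borel_measurable_continuous_onI) (auto intro: closed VW)
  then have meas: "(\<lambda>U. V ** U) \<in> \<mu> \<rightarrow>\<^sub>M \<mu>"
    using measurable_cong_sets[OF sets sets] by blast
  have "distr \<mu> \<mu> (\<lambda>U. V ** U) = \<mu>"
  proof (rule measure_eqI)
    fix A assume "A \<in> sets (distr \<mu> \<mu> (\<lambda>U. V ** U))"
    then have A: "A \<in> sets \<mu>" by simp
    then have "A \<subseteq> H"
      using sets.sets_into_space by fastforce
    \<comment> \<open>Invariance is assumed for images whereas \<open>distr\<close> uses preimages;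
      the preimage under \<open>V\<close> is the image under its inverse \<open>W\<close>.\<close>
    have "(\<lambda>U. V ** U) -` A \<inter> space \<mu> = (\<lambda>U. W ** U) ` A"
    proof (intro equalityI subsetI)
      fix U assume "U \<in> (\<lambda>U. V ** U) -` A \<inter> space \<mu>"
      moreover have "U = W ** (V ** U)"
        by (simp add: matrix_mul_assoc VW)
      ultimately show "U \<in> (\<lambda>U. W ** U) ` A" by blast
    qed (use \<open>A \<subseteq> H\<close> in \<open>auto simp: matrix_mul_assoc VW intro: closed\<close>)
    then have "emeasure (distr \<mu> \<mu> (\<lambda>U. V ** U)) A = emeasure \<mu> ((\<lambda>U. W ** U) ` A)"
      by (simp add: emeasure_distr[OF meas A])
    also have "\<dots> = emeasure \<mu> A"
      using haar VW(2) A by (auto simp: haar_probability_measure_def)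
    finally show "emeasure (distr \<mu> \<mu> (\<lambda>U. V ** U)) A = emeasure \<mu> A" .
  qed simp
  moreover have "f \<in> borel_measurable \<mu>"
    using measurable_cong_sets[OF sets refl] measurable_restrict_space1[OF f] by blast
  ultimately show ?thesis
    using integral_distr[OF meas] by metis
qed

section \<open>Averages of squared Pauli coefficients\<close>

lemma continuous_on_pauli_coeff_conjugate:
  fixes p q :: "('n::finite) operator"
  shows "continuous_on UNIV (\<lambda>U. (cmod (pauli_coeff q (dagger U ** p ** U)))\<^sup>2)"
proof -
  have "continuous_on UNIV (dagger :: 'n operator \<Rightarrow> _)"
    by (intro linear_continuous_on linear_dagger[unfolded linear_conv_bounded_linear])
  then have "continuous_on UNIV (\<lambda>U :: 'n operator. dagger U ** p ** U)"
    by (intro bounded_bilinear.continuous_on[OF bounded_bilinear_matrix_mult] continuous_on_id continuous_on_const)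
  from continuous_on_compose2[OF linear_continuous_on[OF linear_pauli_coeff[of q, unfolded linear_conv_bounded_linear], of UNIV] this]
  have "continuous_on UNIV (\<lambda>U. pauli_coeff q (dagger U ** p ** U))"
    by simp
  then show ?thesis
    by (intro continuous_intros)
qed

lemma average_pauli_coeff:
  fixes \<G> :: "('n::finite) operator set"
  assumes \<G>: "\<G> \<subseteq> pauli_strings" and haar: "haar_probability_measure (generated_lie_group \<G>) \<mu>"
    and p: "p \<in> pauli_strings" and q: "q \<in> graph_component \<G> p"
  shows "integrable \<mu> (\<lambda>U. (cmod (pauli_coeff q (dagger U ** p ** U)))\<^sup>2)" (is "integrable \<mu> (?f p)")
    and "(\<integral>U. (cmod (pauli_coeff q (dagger U ** p ** U)))\<^sup>2 \<partial>\<mu>) = 1 / real (card (graph_component \<G> p))"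
proof -
  let ?C = "graph_component \<G> p" and ?H = "generated_lie_group \<G>"
  have C: "?C \<subseteq> pauli_strings" and "finite ?C"
    using graph_component_subset[OF p, of \<G>] finite_pauli_strings finite_subset by blast+
  have "p \<in> ?C"
    by (simp add: graph_component_def)
  interpret prob_space \<mu>
    using haar by (simp add: haar_probability_measure_def)
  have space: "space \<mu> = ?H"
    using haar_probability_measure_space[OF haar] .
  have meas: "?f a \<in> borel_measurable borel" for a
    by (rule borel_measurable_continuous_onI[OF continuous_on_pauli_coeff_conjugate])
  have sets: "sets \<mu> = sets (restrict_space borel ?H)"
    using haar by (simp add: haar_probability_measure_def)
  \<comment> \<open>The sum runs over the conjugated string \<open>a\<close>, with \<open>q\<close>
    and \<open>U\<close> fixed.\<close>
  have sum_1: "(\<Sum>a\<in>?C. ?f a U) = 1" if U: "U \<in> ?H" for U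
  proof -
    note U_simps = generated_lie_group_unitary[OF \<G> U]
    have "(U ** q ** dagger U) ** (U ** q ** dagger U) = U ** q ** (dagger U ** U) ** q ** dagger U"
      by (simp only: matrix_mul_assoc)
    also have "\<dots> = U ** (q ** q) ** dagger U"
      by (simp add: U_simps matrix_mul_assoc)
    also have "\<dots> = mat 1"
      using q C by (simp add: U_simps pauli_square subset_eq)
    finally have "(U ** q ** dagger U) ** (U ** q ** dagger U) = mat 1" .
    then show ?thesis
      unfolding pauli_coeff_conjugate
      using pauli_Parseval[OF C] conjugate_mem_component_span(1)[OF \<G> p U span_base[OF q]] by blast
  qed
  \<comment> \<open>Each term is bounded by the sum of nonnegative terms, which is 1.\<close>
  have integrable: "integrable \<mu> (?f a)" if "a \<in> ?C" for a
  proof (rule integrable_const_bound[where B = 1])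
    have "?f a U \<le> 1" if "U \<in> ?H" for U
      using member_le_sum[of a ?C "\<lambda>a. ?f a U"] sum_1[OF that] \<open>a \<in> ?C\<close> \<open>finite ?C\<close> by simp
    then show "AE U in \<mu>. norm (?f a U) \<le> 1"
      by (intro AE_I2) (simp add: space)
    show "?f a \<in> borel_measurable \<mu>"
      using measurable_cong_sets[OF sets refl] measurable_restrict_space1[OF meas[of a]] by blast
  qed
  then show "integrable \<mu> (?f p)"
    using \<open>p \<in> ?C\<close> .
  \<comment> \<open>Induction along a path from \<open>p\<close>: each edge is absorbed by one
    translation, and its phase disappears in the modulus.\<close>
  have same: "(\<integral>U. ?f a U \<partial>\<mu>) = (\<integral>U. ?f p U \<partial>\<mu>)" if "a \<in> ?C" for a
  proof -
    have "(p, a) \<in> (commutator_graph \<G>)\<^sup>*"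
      using that by (simp add: graph_component_def)
    then show ?thesis
    proof induction
      case (step a b)
      obtain g c where g: "g \<in> \<G>" "g ** a = - (a ** g)" "g ** a = c *\<^sub>c b" "cmod c = 1"
        using commutator_graph_edgeE[OF \<G> step(2)] by blast
      obtain V where V: "V \<in> ?H" "dagger V \<in> ?H" "dagger V ** a ** V = - \<i> *\<^sub>c (g ** a)"
        using generated_lie_group_rotation[OF \<G> g(1,2)] by blast
      have "dagger (V ** U) ** a ** (V ** U) = dagger U ** (dagger V ** a ** V) ** U" for U
        by (simp only: dagger_mult matrix_mul_assoc)
      then have conj: "dagger (V ** U) ** a ** (V ** U) = (- \<i> * c) *\<^sub>c (dagger U ** b ** U)" for U
        by (simp only: V(3) g(3) mult_cscale cscale_simps(1))
      have "?f a (V ** U) = ?f b U" for U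
        unfolding conj pauli_coeff_cscale by (simp add: norm_mult g(4))
      then have "(\<integral>U. ?f b U \<partial>\<mu>) = (\<integral>U. ?f a (V ** U) \<partial>\<mu>)"
        by simp
      also have "\<dots> = (\<integral>U. ?f a U \<partial>\<mu>)"
        using haar_integral_left_translate[OF haar V(1,2) _ _ meas] generated_lie_group_unitary[OF \<G> V(1)]
        by blast
      finally show ?case
        using step.IH by simp
    qed simp
  qed
  have "1 = (\<integral>U. (\<Sum>a\<in>?C. ?f a U) \<partial>\<mu>)"
    using Bochner_Integration.integral_cong[of \<mu> \<mu> "\<lambda>U. \<Sum>a\<in>?C. ?f a U" "\<lambda>_. 1"] sum_1
    by (simp add: space prob_space[unfolded space])
  also have "\<dots> = (\<Sum>a\<in>?C. \<integral>U. ?f a U \<partial>\<mu>)"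
    by (intro Bochner_Integration.integral_sum integrable)
  also have "\<dots> = real (card ?C) * (\<integral>U. ?f p U \<partial>\<mu>)"
    using same by simp
  finally show "(\<integral>U. ?f p U \<partial>\<mu>) = 1 / real (card ?C)"
    \<comment> \<open>Cardinality zero would turn the derived equation into 1 = 0.\<close>
    by (cases "card ?C = 0") (simp_all add: divide_simps mult.commute)
qed

theorem mainTheorem6:
  fixes \<G> :: "('n::finite) operator set"
    and p :: "'n operator"
    and \<mu> :: "'n operator measure"
  assumes "\<G> \<subseteq> pauli_strings"
    and "haar_probability_measure (generated_lie_group \<G>) \<mu>"
    and "p \<in> pauli_strings"
  shows "(\<integral>U. graph_complexity \<G> p (dagger U ** p ** U) \<partial>\<mu>) =
    1 / real (card (graph_component \<G> p)) *
      (\<Sum>q\<in>graph_component \<G> p. real (path_length \<G> p q))"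
proof -
  let ?C = "graph_component \<G> p"
  note avg = average_pauli_coeff[OF assms]
  \<comment> \<open>Restricting \<open>U\<close> to the group puts the conjugate in the real span of
    the component, where \<open>expansion_coeff\<close> agrees with the trace formula.\<close>
  have "graph_complexity \<G> p (dagger U ** p ** U) =
      (\<Sum>q\<in>?C. real (path_length \<G> p q) * (cmod (pauli_coeff q (dagger U ** p ** U)))\<^sup>2)"
    if "U \<in> space \<mu>" for U
  proof -
    have "U \<in> generated_lie_group \<G>"
      using that haar_probability_measure_space[OF assms(2)] by simp
    moreover have "p \<in> ?C"
      by (simp add: graph_component_def)
    ultimately have "dagger U ** p ** U \<in> span ?C"
      using conjugate_mem_component_span(2)[OF assms(1,3)] span_base by blast
    then show ?thesis
      unfolding graph_complexity_def
      by (intro sum.cong refl) (simp add: expansion_coeff_eq[OF graph_component_subset[OF assms(3)]])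
  qed
  then have "(\<integral>U. graph_complexity \<G> p (dagger U ** p ** U) \<partial>\<mu>) =
      (\<integral>U. (\<Sum>q\<in>?C. real (path_length \<G> p q) * (cmod (pauli_coeff q (dagger U ** p ** U)))\<^sup>2) \<partial>\<mu>)"
    by (intro Bochner_Integration.integral_cong refl)
  also have "\<dots> = (\<Sum>q\<in>?C. real (path_length \<G> p q) * (1 / real (card ?C)))"
    by (subst Bochner_Integration.integral_sum) (simp_all add: avg)
  also have "\<dots> = 1 / real (card ?C) * (\<Sum>q\<in>?C. real (path_length \<G> p q))"
    by (simp add: sum_divide_distrib)
  finally show ?thesis .
qed

end
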